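(* Let $Y=\{-1,1\}$ and let $\ell:Y\times\mathbb{R}\to\mathbb{R}$ be a loss that is robust to label noise. Let $P_+,P_-$ be probability distributions on the instance space $X$, and let $$\tilde P_+=(1-\alpha)P_++\alpha P_-\quad\text{and}\quad \tilde P_-=\beta P_++(1-\beta)P_-,\qquad \alpha,\beta\in[0,1],\ \alpha+\beta<1.$$ Then, for some constant $C$ and for all classifiers $f$, $$\mathrm{BER}_\ell(\tilde P_+,\tilde P_-,f)=(1-\alpha-\beta)\,\mathrm{BER}_\ell(P_+,P_-,f)+\frac{\alpha+\beta}{2}\,C.$$
   Context: A loss is a measurable function $\ell:Y\times\mathbb{R}\to\mathbb{R}$; $X$ is a measurable space; a classifier is a bounded measurable function $f:X\to\mathbb{R}$. The balanced error is $\mathrm{BER}_\ell(P_+,P_-,f)=\frac12\mathbb{E}_{x\sim P_+}\ell(1,f(x))+\frac12\mathbb{E}_{x\sim P_-}\ell(-1,f(x))$. For a probability distribution $Q$ on $\mathbb{R}\times Y$ (over score–label pairs $(v,y)$) and $\sigma\in[0,\frac12)$, $Q_\sigma$ denotes the distribution obtained by drawing $(v,y)\sim Q$ and then flipping the label ($y\mapsto -y$) with probability $\sigma$. Write $Q\le_\ell Q'$ if $\mathbb{E}_{(v,y)\sim Q}\,\ell(y,v)\le\mathbb{E}_{(v,y)\sim Q'}\,\ell(y,v)$. A loss $\ell$ is robust to label noise if for all distributions $Q,Q'$ on $\mathbb{R}\times Y$ and all $\sigma\in[0,\frac12)$: $Q\le_\ell Q'\Leftrightarrow Q_\sigma\le_\ell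 Q'_\sigma$.
   Formalization: Added: a loss with ℓ(1,v)=ℓ(-1,v) for all v must be constant (else it is robust, yet the claim fails for constant classifiers when α+β>0). The identity is claimed for classifiers f for which both expectations in BER(P_+,P_-,f) exist and are finite. *)

theory Defs
  imports "HOL-Probability.Probability"
begin

definition labels :: "int set" where
  "labels = {-1, 1}"

definition loss :: "(int \<times> real \<Rightarrow> real) \<Rightarrow> bool" where
  "loss l \<longleftrightarrow> l \<in> borel_measurable (count_space labels \<Otimes>\<^sub>M borel)"

definition classifier :: "'x measure \<Rightarrow> ('x \<Rightarrow> real) \<Rightarrow> bool" where
  "classifier X f \<longleftrightarrow> f \<in> borel_measurable X \<and> bounded (f ` space X)"

definition distribution_on :: "'a measure \<Rightarrow> 'a measure \<Rightarrow> bool" where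
  "distribution_on X P \<longleftrightarrow> prob_space P \<and> sets P = sets X"

definition score_label_space :: "(real \<times> int) measure" where
  "score_label_space = borel \<Otimes>\<^sub>M count_space labels"

definition label_noise :: "real \<Rightarrow> (real \<times> int) measure \<Rightarrow> (real \<times> int) measure" where
  "label_noise \<sigma> Q =
     distr (Q \<Otimes>\<^sub>M measure_pmf (bernoulli_pmf \<sigma>)) score_label_space
       (\<lambda>((v, y), flip). (v, if flip then - y else y))"

definition has_expected_loss :: "(int \<times> real \<Rightarrow> real) \<Rightarrow> (real \<times> int) measure \<Rightarrow> bool" where
  "has_expected_loss l Q \<longleftrightarrow> integrable Q (\<lambda>(v, y). l (y, v))"

definition expected_loss :: "(int \<times> real \<Rightarrow> real) \<Rightarrow> (real \<times> int) measure \<Rightarrow> real" where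
  "expected_loss l Q = (\<integral>(v, y). l (y, v) \<partial>Q)"

definition loss_le ::
  "(int \<times> real \<Rightarrow> real) \<Rightarrow> (real \<times> int) measure \<Rightarrow> (real \<times> int) measure \<Rightarrow> bool" where
  "loss_le l Q Q' \<longleftrightarrow> expected_loss l Q \<le> expected_loss l Q'"

text \<open>The Bochner integral of a non-integrable function is 0, so the equivalence is only demanded
  when the four expectations being compared exist.\<close>

definition robust_to_label_noise :: "(int \<times> real \<Rightarrow> real) \<Rightarrow> bool" where
  "robust_to_label_noise l \<longleftrightarrow>
     (\<forall>Q Q' \<sigma>. distribution_on score_label_space Q \<longrightarrow> distribution_on score_label_space Q' \<longrightarrow>
        0 \<le> \<sigma> \<longrightarrow> \<sigma> < 1/2 \<longrightarrow>
        has_expected_loss l Q \<longrightarrow> has_expected_loss l Q' \<longrightarrow>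
        has_expected_loss l (label_noise \<sigma> Q) \<longrightarrow> has_expected_loss l (label_noise \<sigma> Q') \<longrightarrow>
        (loss_le l Q Q' \<longleftrightarrow> loss_le l (label_noise \<sigma> Q) (label_noise \<sigma> Q')))"

text \<open>The measure \<open>a M + b N\<close>, for \<open>a, b \<ge> 0\<close> and measures on the same \<open>\<sigma>\<close>-algebra.\<close>

definition mixture :: "real \<Rightarrow> 'a measure \<Rightarrow> real \<Rightarrow> 'a measure \<Rightarrow> 'a measure" where
  "mixture a M b N = measure_of (space M) (sets M)
     (\<lambda>A. ennreal a * emeasure M A + ennreal b * emeasure N A)"

lemma space_mixture [simp]: "space (mixture a M b N) = space M"
  by (simp add: mixture_def)

lemma sets_mixture [simp, measurable_cong]: "sets (mixture a M b N) = sets M"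
  by (simp add: mixture_def)

lemma emeasure_mixture:
  assumes "sets N = sets M" and A: "A \<in> sets M"
  shows "emeasure (mixture a M b N) A = ennreal a * emeasure M A + ennreal b * emeasure N A"
  unfolding mixture_def
proof (rule emeasure_measure_of_sigma[OF _ _ _ A])
  show "countably_additive (sets M) (\<lambda>A. ennreal a * emeasure M A + ennreal b * emeasure N A)"
  proof (rule countably_additiveI)
    fix F :: "nat \<Rightarrow> 'a set"
    assume F: "range F \<subseteq> sets M" "disjoint_family F"
    have "(\<Sum>i. ennreal a * emeasure M (F i) + ennreal b * emeasure N (F i)) =
      ennreal a * (\<Sum>i. emeasure M (F i)) + ennreal b * (\<Sum>i. emeasure N (F i))"
      by (simp add: suminf_add[symmetric])
    then show "(\<Sum>i. ennreal a * emeasure M (F i) + ennreal b * emeasure N (F i)) =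
      ennreal a * emeasure M (\<Union>i. F i) + ennreal b * emeasure N (\<Union>i. F i)"
      using F assms(1) by (simp add: suminf_emeasure)
  qed
qed (auto simp: positive_def sets.sigma_algebra_axioms)

definition has_BER ::
  "(int \<times> real \<Rightarrow> real) \<Rightarrow> 'x measure \<Rightarrow> 'x measure \<Rightarrow> ('x \<Rightarrow> real) \<Rightarrow> bool" where
  "has_BER l P N f \<longleftrightarrow> integrable P (\<lambda>x. l (1, f x)) \<and> integrable N (\<lambda>x. l (-1, f x))"

definition BER ::
  "(int \<times> real \<Rightarrow> real) \<Rightarrow> 'x measure \<Rightarrow> 'x measure \<Rightarrow> ('x \<Rightarrow> real) \<Rightarrow> real" where
  "BER l P N f = 1/2 * (\<integral>x. l (1, f x) \<partial>P) + 1/2 * (\<integral>x. l (-1, f x) \<partial>N)"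

text \<open>Every loss that ignores the label is robust to label noise, whatever its dependence on the
  score. For constant classifiers \<open>f = v\<close> and such a loss, the mixture identity for the balanced
  error reads \<open>(\<alpha> + \<beta>) * l (1, v) = (\<alpha> + \<beta>) / 2 * C\<close>, which no single \<open>C\<close> satisfies
  for all \<open>v\<close> if \<open>l\<close> is not constant and \<open>\<alpha> + \<beta> > 0\<close>. Hence robustness has to be supplemented by the
  assumption that a loss that ignores the label is constant.\<close>

lemma measurable_flip_label:
  "(\<lambda>((v, y), flip). (v, if flip then - y else y)) \<in>
     score_label_space \<Otimes>\<^sub>M count_space (UNIV :: bool set) \<rightarrow>\<^sub>M score_label_space"
proof -
  let ?S = "score_label_space \<Otimes>\<^sub>M count_space (UNIV :: bool set)"
  have neg: "uminus \<in> count_space labels \<rightarrow>\<^sub>M count_space labels"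
    by (auto simp: labels_def)
  have v: "(\<lambda>z. fst (fst z)) \<in> ?S \<rightarrow>\<^sub>M borel"
    and y: "(\<lambda>z. snd (fst z)) \<in> ?S \<rightarrow>\<^sub>M count_space labels"
    unfolding score_label_space_def by measurable
  have "(\<lambda>z. (fst (fst z), if snd z then - snd (fst z) else snd (fst z))) \<in> ?S \<rightarrow>\<^sub>M score_label_space"
    unfolding score_label_space_def
    by (intro measurable_Pair measurable_If measurable_compose[OF y neg, unfolded score_label_space_def]
      y[unfolded score_label_space_def] v[unfolded score_label_space_def])
      (use measurable_snd in \<open>auto simp: pred_def[symmetric]\<close>)
  then show ?thesis
    by (simp add: case_prod_unfold)
qed

lemma robust_if_label_independent:
  assumes l: "loss l" and indep: "\<And>v. l (1, v) = l (-1, v)"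
  shows "robust_to_label_noise l"
proof -
  have "expected_loss l (label_noise \<sigma> Q) = expected_loss l Q"
    if Q: "distribution_on score_label_space Q" for \<sigma> Q
  proof -
    let ?B = "measure_pmf (bernoulli_pmf \<sigma>)"
    let ?F = "\<lambda>((v, y), flip). (v, if flip then - y else y)"
    let ?g = "\<lambda>(v, y). l (y, v)"
    have sets_Q [measurable_cong]: "sets Q = sets score_label_space"
      using Q by (simp add: distribution_on_def)
    have sp: "space Q = UNIV \<times> labels"
      using sets_eq_imp_space_eq[OF sets_Q] by (simp add: score_label_space_def space_pair_measure)
    have [measurable]: "l \<in> borel_measurable (count_space labels \<Otimes>\<^sub>M borel)"
      using l by (simp add: loss_def)
    have g: "?g \<in> borel_measurable score_label_space"
      unfolding score_label_space_def by measurable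
    have gQ: "?g \<in> borel_measurable Q"
      using g by measurable
    have flip: "?F \<in> Q \<Otimes>\<^sub>M ?B \<rightarrow>\<^sub>M score_label_space"
      using measurable_flip_label
      by (subst measurable_cong_sets[OF sets_pair_measure_cong refl]) (auto simp: sets_Q)
    have "expected_loss l (label_noise \<sigma> Q) =
      (\<integral>z. ?g (?F z) \<partial>(Q \<Otimes>\<^sub>M ?B))"
      unfolding expected_loss_def label_noise_def by (rule integral_distr[OF flip g])
    also have "\<dots> = (\<integral>z. ?g (fst z) \<partial>(Q \<Otimes>\<^sub>M ?B))"
      using indep by (intro Bochner_Integration.integral_cong)
        (auto simp: space_pair_measure sp labels_def split: if_splits)
    also have "\<dots> = (\<integral>z. ?g z \<partial>distr (Q \<Otimes>\<^sub>M ?B) Q fst)"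
      by (rule integral_distr[symmetric, OF _ gQ]) simp
    finally show ?thesis
      by (simp add: prob_space.distr_pair_fst prob_space_measure_pmf expected_loss_def)
  qed
  then show ?thesis
    by (simp add: robust_to_label_noise_def loss_le_def)
qed

end

theory Submission
  imports Defs
begin

text \<open>
  Write \<open>g (v, y) = l (y, v)\<close> and \<open>g' (v, y) = l (-y, v)\<close>. Label noise turns \<open>E g\<close> into
  \<open>(1 - \<sigma>) E g + \<sigma> E g'\<close>, so robustness for a single \<open>\<sigma> > 0\<close> forces \<open>D g' = 0\<close> for every finitely
  supported signed measure \<open>D\<close> of total mass 0 with \<open>D g = 0\<close>. If \<open>p = g (v, 1)\<close> and
  \<open>q = g (v, -1)\<close> differ, let \<open>s = g (w, 1)\<close> and take for \<open>D\<close> the weights \<open>s - q\<close>, \<open>p - s\<close>, \<open>q - p\<close> at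
  \<open>(v, 1)\<close>, \<open>(v, -1)\<close>, \<open>(w, 1)\<close>; then \<open>D g' = 0\<close> says \<open>g (w, 1) + g (w, -1) = p + q\<close>. So
  \<open>l (1, w) + l (-1, w)\<close> does not depend on \<open>w\<close>, which is the symmetry that makes the balanced error
  affine under contamination of the class distributions. If \<open>l\<close> ignores the label, it is constant by
  the nondegeneracy assumption and has the same symmetry.
\<close>

section \<open>Expected loss under label noise\<close>

lemma borel_measurable_score_label:
  assumes "loss l"
  shows "(\<lambda>(v, y). l (y, v)) \<in> borel_measurable score_label_space"
proof -
  have [measurable]: "l \<in> borel_measurable (count_space labels \<Otimes>\<^sub>M borel)"
    using assms by (simp add: loss_def)
  show ?thesis
    unfolding score_label_space_def by measurable
qed

text \<open>By Fubini, integrating out the coin first leaves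
  \<open>(1 - \<sigma>) * l (y, v) + \<sigma> * l (-y, v)\<close>. Integrability of the flipped loss
  is a separate hypothesis, as it does not follow from that of the loss itself.\<close>

lemma
  assumes l: "loss l" and \<sigma>: "0 \<le> \<sigma>" "\<sigma> \<le> 1"
    and Q: "distribution_on score_label_space Q"
    and g: "has_expected_loss l Q" and g': "integrable Q (\<lambda>(v, y). l (-y, v))"
  shows has_expected_loss_label_noise: "has_expected_loss l (label_noise \<sigma> Q)"
    and expected_loss_label_noise: "expected_loss l (label_noise \<sigma> Q) =
      (1 - \<sigma>) * expected_loss l Q + \<sigma> * (\<integral>(v, y). l (-y, v) \<partial>Q)"
proof -
  let ?B = "measure_pmf (bernoulli_pmf \<sigma>)"
  let ?F = "\<lambda>((v, y), flip). (v, if flip then - y else y)"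
  let ?g = "\<lambda>(v, y). l (y, v)" and ?g' = "\<lambda>(v, y). l (-y, v)"
  have sets_Q: "sets Q = sets score_label_space" and "prob_space Q"
    using Q by (simp_all add: distribution_on_def)
  interpret Q: prob_space Q by fact
  interpret pair_prob_space Q ?B ..
  have gm: "?g \<in> borel_measurable score_label_space"
    using l by (rule borel_measurable_score_label)
  have flip: "?F \<in> Q \<Otimes>\<^sub>M ?B \<rightarrow>\<^sub>M score_label_space"
    using measurable_flip_label
    by (subst measurable_cong_sets[OF sets_pair_measure_cong refl]) (auto simp: sets_Q)
  have fst_int: "integrable (Q \<Otimes>\<^sub>M ?B) (\<lambda>z. h (fst z))" if "integrable Q h" for h :: "real \<times> int \<Rightarrow> real"
  proof -
    have "integrable (distr (Q \<Otimes>\<^sub>M ?B) Q fst) h"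
      using that by (simp add: prob_space.distr_pair_fst prob_space_measure_pmf)
    then show ?thesis
      by (rule integrable_distr[rotated]) simp
  qed
  have gi: "integrable Q ?g"
    using g by (simp add: has_expected_loss_def)
  have int: "integrable (Q \<Otimes>\<^sub>M ?B) (\<lambda>z. ?g (?F z))"
  \<comment> \<open>Whichever way the coin falls, the integrand is \<open>?g\<close> or
    \<open>?g'\<close> at the original pair.\<close>
  proof (rule Bochner_Integration.integrable_bound)
    show "integrable (Q \<Otimes>\<^sub>M ?B) (\<lambda>z. \<bar>?g (fst z)\<bar> + \<bar>?g' (fst z)\<bar>)"
      using fst_int[OF gi] fst_int[OF g'] by (intro Bochner_Integration.integrable_add integrable_abs)
    show "(\<lambda>z. ?g (?F z)) \<in> borel_measurable (Q \<Otimes>\<^sub>M ?B)"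
      using measurable_compose[OF flip gm] .
  qed (auto intro!: AE_I2)
  then show "has_expected_loss l (label_noise \<sigma> Q)"
    unfolding has_expected_loss_def label_noise_def
    by (subst integrable_distr_eq[OF flip gm])
  have "expected_loss l (label_noise \<sigma> Q) = (\<integral>z. ?g (?F z) \<partial>(Q \<Otimes>\<^sub>M ?B))"
    unfolding expected_loss_def label_noise_def by (rule integral_distr[OF flip gm])
  also have "\<dots> = (\<integral>x. (\<integral>b. ?g (?F (x, b)) \<partial>?B) \<partial>Q)"
    using int by (rule integral_fst'[symmetric])
  also have "\<dots> = (\<integral>x. (1 - \<sigma>) * ?g x + \<sigma> * ?g' x \<partial>Q)"
    using \<sigma> by (intro Bochner_Integration.integral_cong) (auto simp: algebra_simps)
  also have "\<dots> = (1 - \<sigma>) * (\<integral>x. ?g x \<partial>Q) + \<sigma> * (\<integral>x. ?g' x \<partial>Q)"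
    using gi g' by simp
  finally show "expected_loss l (label_noise \<sigma> Q) =
      (1 - \<sigma>) * expected_loss l Q + \<sigma> * (\<integral>(v, y). l (-y, v) \<partial>Q)"
    by (simp add: expected_loss_def)
qed

section \<open>Robustness tested on finitely supported distributions\<close>

lemma
  assumes "\<And>i. snd (h i) \<in> labels"
  shows distribution_on_distr_pmf: "distribution_on score_label_space (distr (measure_pmf p) score_label_space h)"
    and measurable_pmf_score_label: "h \<in> measure_pmf p \<rightarrow>\<^sub>M score_label_space"
proof -
  show *: "h \<in> measure_pmf p \<rightarrow>\<^sub>M score_label_space"
    using assms by (auto simp: score_label_space_def space_pair_measure mem_Times_iff)
  show "distribution_on score_label_space (distr (measure_pmf p) score_label_space h)"
    using * by (simp add: distribution_on_def measure_pmf.prob_space_distr)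
qed

text \<open>Equal expectations amount to the order in both directions, which robustness carries over
  to the noisy distributions; cancelling the unflipped part there leaves the flipped one. Weights
  sit on indices, so \<open>h\<close> may repeat a point.\<close>

lemma robust_pmf_flipped_eq:
  fixes p p' :: "'i pmf"
  assumes l: "loss l" and robust: "robust_to_label_noise l"
    and h: "\<And>i. snd (h i) \<in> labels"
    and fin: "finite (set_pmf p)" "finite (set_pmf p')"
    and eq: "measure_pmf.expectation p (\<lambda>i. l (snd (h i), fst (h i))) =
      measure_pmf.expectation p' (\<lambda>i. l (snd (h i), fst (h i)))"
  shows "measure_pmf.expectation p (\<lambda>i. l (- snd (h i), fst (h i))) =
      measure_pmf.expectation p' (\<lambda>i. l (- snd (h i), fst (h i)))"
proof -
  let ?Q = "\<lambda>p. distr (measure_pmf p) score_label_space h"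
  let ?g = "\<lambda>(v, y). l (y, v)" and ?g' = "\<lambda>(v, y). l (-y, v)"
  note D = distribution_on_distr_pmf[of h, OF h] measurable_pmf_score_label[of h, OF h]
  have gm: "?g \<in> borel_measurable score_label_space"
    using l by (rule borel_measurable_score_label)
  have g'm: "?g' \<in> borel_measurable score_label_space"
  proof -
    have "(\<lambda>(v, y). (v, -y)) \<in> score_label_space \<rightarrow>\<^sub>M score_label_space"
      unfolding score_label_space_def case_prod_unfold
      by (intro measurable_Pair measurable_compose[OF measurable_snd]) (auto simp: labels_def)
    from measurable_compose[OF this gm] show ?thesis
      by (simp add: case_prod_unfold)
  qed
  have e: "has_expected_loss l (?Q r)" "integrable (?Q r) ?g'"
    "expected_loss l (?Q r) = measure_pmf.expectation r (\<lambda>i. l (snd (h i), fst (h i)))"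
    "(\<integral>x. ?g' x \<partial>(?Q r)) = measure_pmf.expectation r (\<lambda>i. l (- snd (h i), fst (h i)))"
    if "finite (set_pmf r)" for r
    using that
    by (simp_all add: has_expected_loss_def expected_loss_def integrable_distr_eq[OF D(2) gm]
      integrable_distr_eq[OF D(2) g'm] integral_distr[OF D(2) gm] integral_distr[OF D(2) g'm]
      integrable_measure_pmf_finite) (simp_all add: case_prod_unfold)
  \<comment> \<open>Any noise level strictly between 0 and 1/2 would serve: the flipped part must
    get nonzero weight.\<close>
  note noise = has_expected_loss_label_noise[OF l _ _ D(1), of "1/4"]
    expected_loss_label_noise[OF l _ _ D(1), of "1/4"]
  have "loss_le l (?Q r) (?Q r') \<longleftrightarrow> loss_le l (label_noise (1/4) (?Q r)) (label_noise (1/4) (?Q r'))"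
    if "finite (set_pmf r)" "finite (set_pmf r')" for r r'
    using robust[unfolded robust_to_label_noise_def, rule_format, of "?Q r" "?Q r'" "1/4"]
      D(1) e[OF that(1)] e[OF that(2)] noise by simp
  from this[OF fin] this[OF fin(2,1)] show ?thesis
    using eq e[OF fin(1)] e[OF fin(2)] noise(2) by (simp add: loss_le_def)
qed

lemma robust_loss_symmetric:
  assumes l: "loss l" and robust: "robust_to_label_noise l"
    and neq: "l (1, v) \<noteq> l (-1, v)"
  shows "l (1, w) + l (-1, w) = l (1, v) + l (-1, v)"
proof -
  define p q s t where "p = l (1, v)" and "q = l (-1, v)" and "s = l (1, w)" and "t = l (-1, w)"
  define S where "S = 3 * (\<bar>s - q\<bar> + \<bar>p - s\<bar> + \<bar>q - p\<bar>)"
  \<comment> \<open>Only indices 0, 1, 2 carry mass; \<open>mod 3\<close> keeps the label valid at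
    every index.\<close>
  define h :: "nat \<Rightarrow> real \<times> int" where "h i = [(v, 1), (v, -1), (w, 1)] ! (i mod 3)" for i
  have "p \<noteq> q"
    using neq by (simp add: p_def q_def)
  then have S: "S > 0"
    by (simp add: S_def add_nonneg_pos)
  have "i mod 3 = 0 \<or> i mod 3 = 1 \<or> i mod 3 = 2" for i :: nat
    by auto
  then have h: "snd (h i) \<in> labels" for i
    unfolding h_def labels_def by (metis (no_types) One_nat_def insertCI insert_commute
      nth_Cons_0 nth_Cons_Suc numeral_2_eq_2 snd_conv)
  have pmf: "\<exists>P::nat pmf. finite (set_pmf P) \<and>
      (\<forall>f :: nat \<Rightarrow> real. measure_pmf.expectation P f = a * f 0 + b * f 1 + c * f 2)"
    if "a \<ge> 0" "b \<ge> 0" "c \<ge> 0" "a + b + c = 1" for a b c :: real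
  proof -
    let ?xs = "[(0::nat, a), (1, b), (2, c)]"
    have wf: "pmf_of_list_wf ?xs"
      using that by (auto simp: pmf_of_list_wf_def)
    have sub: "set_pmf (pmf_of_list ?xs) \<subseteq> {0, 1, 2}"
      using set_pmf_of_list[OF wf] by auto
    have "measure_pmf.expectation (pmf_of_list ?xs) f = a * f 0 + b * f 1 + c * f 2" for f :: "nat \<Rightarrow> real"
    proof -
      have "pmf (pmf_of_list ?xs) 0 = a" "pmf (pmf_of_list ?xs) 1 = b" "pmf (pmf_of_list ?xs) 2 = c"
        by (simp_all only: pmf_pmf_of_list[OF wf]) simp_all
      moreover have "measure_pmf.expectation (pmf_of_list ?xs) f =
          (\<Sum>i\<in>{0, 1, 2}. pmf (pmf_of_list ?xs) i *\<^sub>R f i)"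
        using sub by (intro integral_measure_pmf) auto
      ultimately show ?thesis
        by simp
    qed
    then show ?thesis
      using finite_subset[OF sub] by blast
  qed
  txt \<open>The difference of \<open>P'\<close> and the uniform distribution \<open>P\<close> is \<open>D / S\<close>, where \<open>S\<close> is large
    enough to make the weights of \<open>P'\<close> nonnegative.\<close>
  obtain P :: "nat pmf" where P: "finite (set_pmf P)"
    "\<And>f :: nat \<Rightarrow> real. measure_pmf.expectation P f = 1/3 * f 0 + 1/3 * f 1 + 1/3 * f 2"
    using pmf[of "1/3" "1/3" "1/3"] by auto
  \<comment> \<open>A perturbation \<open>x / S\<close> of size at most 1/3 cannot make a uniform
    weight negative.\<close>
  have bound: "1/3 + x / S \<ge> 0" if "3 * \<bar>x\<bar> \<le> S" for x
    using S that by (simp add: field_simps)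
  have "1/3 + (s - q) / S \<ge> 0" "1/3 + (p - s) / S \<ge> 0" "1/3 + (q - p) / S \<ge> 0"
    by (rule bound, simp add: S_def)+
  moreover have "(1/3 + (s - q) / S) + (1/3 + (p - s) / S) + (1/3 + (q - p) / S) = 1"
    by (simp add: diff_divide_distrib)
  ultimately obtain P' :: "nat pmf" where P': "finite (set_pmf P')"
    "\<And>f :: nat \<Rightarrow> real. measure_pmf.expectation P' f =
      (1/3 + (s - q) / S) * f 0 + (1/3 + (p - s) / S) * f 1 + (1/3 + (q - p) / S) * f 2"
    using pmf by metis
  have h012: "h 0 = (v, 1)" "h 1 = (v, -1)" "h 2 = (w, 1)" "h (Suc 0) = (v, -1)"
    by (simp_all add: h_def numeral_2_eq_2)
  have "measure_pmf.expectation P' (\<lambda>i. l (- snd (h i), fst (h i))) =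
      measure_pmf.expectation P (\<lambda>i. l (- snd (h i), fst (h i)))"
  proof (rule robust_pmf_flipped_eq[OF l robust h P'(1) P(1)])
    have "((s - q) * p + (p - s) * q + (q - p) * s) / S = 0"
      by (simp add: algebra_simps)
    then show "measure_pmf.expectation P' (\<lambda>i. l (snd (h i), fst (h i))) =
      measure_pmf.expectation P (\<lambda>i. l (snd (h i), fst (h i)))"
      unfolding P(2) P'(2) h012 fst_conv snd_conv p_def[symmetric] q_def[symmetric] s_def[symmetric]
      by (simp add: add_divide_distrib distrib_right)
  qed
  \<comment> \<open>Flipping replaces the values \<open>p\<close>, \<open>q\<close>,
    \<open>s\<close> by \<open>q\<close>, \<open>p\<close>, \<open>t\<close>. The numerator factors
    as \<open>(q - p) * (s + t - (p + q))\<close>.\<close>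
  then have "((s - q) * q + (p - s) * p + (q - p) * t) / S = 0"
    unfolding P(2) P'(2) h012 fst_conv snd_conv minus_minus p_def[symmetric] q_def[symmetric] t_def[symmetric]
    by (simp add: add_divide_distrib distrib_right) argo
  then have "(q - p) * (s + t - (p + q)) = 0"
    using S by (simp add: algebra_simps)
  then show ?thesis
    using \<open>p \<noteq> q\<close> by (simp add: p_def q_def s_def t_def)
qed

section \<open>Integration against mixtures\<close>

lemma nn_integral_mixture:
  assumes "f \<in> borel_measurable M" and N: "sets N = sets M"
  shows "(\<integral>\<^sup>+x. f x \<partial>mixture a M b N) = ennreal a * (\<integral>\<^sup>+x. f x \<partial>M) + ennreal b * (\<integral>\<^sup>+x. f x \<partial>N)"
  using assms(1)
proof (induction f rule: borel_measurable_induct)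
  case (cong f g)
  have "space N = space M"
    using N by (rule sets_eq_imp_space_eq)
  with cong(3) have "integral\<^sup>N (mixture a M b N) f = integral\<^sup>N (mixture a M b N) g"
    "integral\<^sup>N M f = integral\<^sup>N M g" "integral\<^sup>N N f = integral\<^sup>N N g"
    by (auto intro!: nn_integral_cong)
  with cong(4) show ?case
    by simp
next
  case (set A)
  then show ?case
    using N by (simp add: emeasure_mixture)
next
  case (mult u c)
  then have "u \<in> borel_measurable (mixture a M b N)" "u \<in> borel_measurable N"
    using N by (auto cong: measurable_cong_sets)
  with mult show ?case
    by (simp add: nn_integral_cmult distrib_left mult.left_commute)
next
  case (add u v)
  then have "u \<in> borel_measurable (mixture a M b N)" "u \<in> borel_measurable N"
     "v \<in> borel_measurable (mixture a M b N)" "v \<in> borel_measurable N"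
    using N by (auto cong: measurable_cong_sets)
  with add show ?case
    by (simp add: nn_integral_add distrib_left ac_simps)
next
  case (seq U)
  then have m: "\<And>i. U i \<in> borel_measurable (mixture a M b N)" "\<And>i. U i \<in> borel_measurable N"
    using N by (auto cong: measurable_cong_sets)
  \<comment> \<open>Monotonicity of both summands lets the supremum of the sum split.\<close>
  have inc: "incseq (\<lambda>i. ennreal c * (\<integral>\<^sup>+x. U i x \<partial>K))" for c K
    using seq(3) by (auto simp: incseq_def le_fun_def intro!: mult_left_mono nn_integral_mono)
  show ?case
    using seq m inc
    by (simp add: image_comp nn_integral_monotone_convergence_SUP[OF seq(3)] SUP_mult_left_ennreal
      ennreal_SUP_add SUP_apply[abs_def])
qed

text \<open>Positive and negative parts have finite integrals under both measures, so the identity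
  for nonnegative functions descends to the reals.\<close>

lemma integral_mixture:
  fixes f :: "'a \<Rightarrow> real"
  assumes N: "sets N = sets M" and ab: "0 \<le> a" "0 \<le> b"
    and M_int: "integrable M f" and N_int: "integrable N f"
  shows "(\<integral>x. f x \<partial>mixture a M b N) = a * (\<integral>x. f x \<partial>M) + b * (\<integral>x. f x \<partial>N)"
proof -
  have fm: "f \<in> borel_measurable M" "f \<in> borel_measurable (mixture a M b N)"
    using M_int by (auto cong: measurable_cong_sets)
  have nn: "(\<integral>\<^sup>+x. ennreal (g x) \<partial>mixture a M b N) = ennreal (a * enn2real (\<integral>\<^sup>+x. ennreal (g x) \<partial>M) +
        b * enn2real (\<integral>\<^sup>+x. ennreal (g x) \<partial>N))"
    if "g \<in> borel_measurable M" "(\<integral>\<^sup>+x. ennreal (g x) \<partial>M) < \<infinity>" "(\<integral>\<^sup>+x. ennreal (g x) \<partial>N) < \<infinity>"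
    for g :: "'a \<Rightarrow> real"
    using that N ab by (simp add: nn_integral_mixture ennreal_plus ennreal_mult)
  have fin: "(\<integral>\<^sup>+x. ennreal (f x) \<partial>M) < \<infinity>" "(\<integral>\<^sup>+x. ennreal (- f x) \<partial>M) < \<infinity>"
      "(\<integral>\<^sup>+x. ennreal (f x) \<partial>N) < \<infinity>" "(\<integral>\<^sup>+x. ennreal (- f x) \<partial>N) < \<infinity>"
    using M_int N_int by (auto simp: real_integrable_def less_top)
  have int: "integrable (mixture a M b N) f"
    using fin fm nn[of f] nn[of "\<lambda>x. - f x"] by (simp add: real_integrable_def)
  show ?thesis
    using ab fin fm
    unfolding real_lebesgue_integral_def[OF int] real_lebesgue_integral_def[OF M_int]
      real_lebesgue_integral_def[OF N_int]
    by (simp add: nn del: ennreal_plus) (simp add: algebra_simps)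
qed

theorem theorem18:
  fixes X P_pos P_neg :: "'x measure" and l :: "int \<times> real \<Rightarrow> real" and \<alpha> \<beta> :: real
  assumes "loss l" and "robust_to_label_noise l"
    and nondegenerate: "(\<forall>v. l (1, v) = l (-1, v)) \<longrightarrow> (\<exists>c. \<forall>v. l (1, v) = c)"
    and "distribution_on X P_pos" and "distribution_on X P_neg"
    and "\<alpha> \<in> {0..1}" and "\<beta> \<in> {0..1}" and "\<alpha> + \<beta> < 1"
  shows "\<exists>C. \<forall>f. classifier X f \<longrightarrow> has_BER l P_pos P_neg f \<longrightarrow>
    BER l (mixture (1 - \<alpha>) P_pos \<alpha> P_neg) (mixture \<beta> P_pos (1 - \<beta>) P_neg) f =
      (1 - \<alpha> - \<beta>) * BER l P_pos P_neg f + (\<alpha> + \<beta>) / 2 * C"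
proof -
  \<comment> \<open>\<open>C\<close> depends on the loss alone, hence serves all classifiers at
    once.\<close>
  obtain C where C: "l (1, v) + l (-1, v) = C" for v
  proof (cases "\<forall>v. l (1, v) = l (-1, v)")
    case True
    with nondegenerate obtain c where "\<forall>v. l (1, v) = c"
      by blast
    with True that[of "c + c"] show thesis
      by auto
  next
    case False
    then show thesis
      using that robust_loss_symmetric[OF assms(1,2)] by blast
  qed
  interpret P: prob_space P_pos
    using assms(4) by (simp add: distribution_on_def)
  interpret N: prob_space P_neg
    using assms(5) by (simp add: distribution_on_def)
  have sets: "sets P_neg = sets P_pos"
    using assms(4,5) by (simp add: distribution_on_def)
  have flip: "l (-1, v) = C - l (1, v)" "l (1, v) = C - l (-1, v)" for v
    using C[of v] by auto
  have "BER l (mixture (1 - \<alpha>) P_pos \<alpha> P_neg) (mixture \<beta> P_pos (1 - \<beta>) P_neg) f =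
      (1 - \<alpha> - \<beta>) * BER l P_pos P_neg f + (\<alpha> + \<beta>) / 2 * C"
    if "has_BER l P_pos P_neg f" for f
  proof -
    have int: "integrable P_pos (\<lambda>x. l (1, f x))" "integrable P_neg (\<lambda>x. l (-1, f x))"
      using that by (simp_all add: has_BER_def)
    \<comment> \<open>Contamination brings in the crossed expectations, about which
      \<open>has_BER\<close> is silent. Symmetry and total mass 1 express each as \<open>C\<close>
      minus a known one.\<close>
    have P': "integrable P_pos (\<lambda>x. l (-1, f x))"
        "(\<integral>x. l (-1, f x) \<partial>P_pos) = C - (\<integral>x. l (1, f x) \<partial>P_pos)"
      unfolding flip(1) using int(1) by (simp_all add: P.prob_space)
    have N': "integrable P_neg (\<lambda>x. l (1, f x))"
        "(\<integral>x. l (1, f x) \<partial>P_neg) = C - (\<integral>x. l (-1, f x) \<partial>P_neg)"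
      unfolding flip(2) using int(2) by (simp_all add: N.prob_space)
    show ?thesis
      using assms(6,7) int P' N' sets
      by (simp add: BER_def integral_mixture) (simp add: field_simps)
  qed
  then show ?thesis
    by blast
qed

end
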